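(* Let $\mathcal{H}$ be a complex Hilbert space and let $A\in\mathcal{B}(\mathcal{H})$. For $0\le t\le 1$ put $r=\min\{t,1-t\}$ and $R=\max\{t,1-t\}$. Then for any $0\le t\le 1$, \[\frac1R\left((1-t)\left\|\mathfrak{R}A\right\|+t\left\|\mathfrak{I}A\right\|-\frac12\omega_t(A)\right)\le\left\|\mathfrak{R}A\right\|+\left\|\mathfrak{I}A\right\|-\omega(A),\] and for any $0<t<1$, \[\left\|\mathfrak{R}A\right\|+\left\|\mathfrak{I}A\right\|-\omega(A)\le\frac1r\left((1-t)\left\|\mathfrak{R}A\right\|+t\left\|\mathfrak{I}A\right\|-\frac12\omega_t(A)\right).\] In particular, \[2\int_0^1\omega_t(A)\,dt-\left(\left\|\mathfrak{R}A\right\|+\left\|\mathfrak{I}A\right\|\right)\le\omega(A)\le\frac23\int_0^1\omega_t(A)\,dt+\frac13\left(\left\|\mathfrak{R}A\right\|+\left\|\mathfrak{I}A\right\|\right).\]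
   Context: $\mathcal{B}(\mathcal{H})$ is the $C^*$-algebra of bounded linear operators on the complex Hilbert space $\mathcal{H}$, with operator norm $\|\cdot\|$. $\mathfrak{R}A=\frac{A+A^*}{2}$ and $\mathfrak{I}A=\frac{A-A^*}{2\mathrm{i}}$. The numerical radius is $\omega(A)=\sup_{\|x\|=1}|\langle Ax,x\rangle|$. For $0\le t\le 1$, the $t$-weighted numerical radius of $A$ is $\omega_t(A)=\omega\left((1-2t)A^*+A\right)$. *)

theory Defs
  imports "HOL-Analysis.Analysis"
begin

class complex_vector = real_vector +
  fixes scaleC :: "complex \<Rightarrow> 'a \<Rightarrow> 'a"  (infixr \<open>*\<^sub>C\<close> 75)
  assumes scaleC_add_right: "a *\<^sub>C (x + y) = a *\<^sub>C x + a *\<^sub>C y"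
    and scaleC_add_left: "(a + b) *\<^sub>C x = a *\<^sub>C x + b *\<^sub>C x"
    and scaleC_scaleC: "a *\<^sub>C (b *\<^sub>C x) = (a * b) *\<^sub>C x"
    and scaleC_one: "1 *\<^sub>C x = x"
    and scaleR_scaleC: "r *\<^sub>R x = complex_of_real r *\<^sub>C x"

text \<open>The inner product is linear in its first argument and conjugate-linear in its second.\<close>

class complex_inner = complex_vector + real_normed_vector +
  fixes cinner :: "'a \<Rightarrow> 'a \<Rightarrow> complex"
  assumes cinner_commute: "cinner x y = cnj (cinner y x)"
    and cinner_add_left: "cinner (x + y) z = cinner x z + cinner y z"
    and cinner_scaleC_left: "cinner (c *\<^sub>C x) y = c * cinner x y"
    and cinner_ge_zero: "0 \<le> Re (cinner x x)"
    and cinner_eq_zero_iff: "cinner x x = 0 \<longleftrightarrow> x = 0"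
    and norm_eq_sqrt_cinner: "norm x = sqrt (Re (cinner x x))"

class chilbert_space = complex_inner + complete_space

text \<open>Elements of \<open>B(H)\<close> are functions satisfying the following predicate; their operator norm
  is the library's \<^const>\<open>onorm\<close>.\<close>

definition bounded_clinear :: "('a::complex_inner \<Rightarrow> 'a) \<Rightarrow> bool" where
  "bounded_clinear A \<longleftrightarrow> bounded_linear A \<and> (\<forall>c x. A (c *\<^sub>C x) = c *\<^sub>C A x)"

text \<open>The defining equation determines the adjoint uniquely; existence, for bounded operators on a
  Hilbert space, is a consequence of the Riesz representation theorem.\<close>

definition cadjoint :: "('a::chilbert_space \<Rightarrow> 'a) \<Rightarrow> 'a \<Rightarrow> 'a" where
  "cadjoint A = (THE B. \<forall>x y. cinner (A x) y = cinner x (B y))"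

definition re_part :: "('a::chilbert_space \<Rightarrow> 'a) \<Rightarrow> 'a \<Rightarrow> 'a" where
  "re_part A = (\<lambda>x. (1 / 2) *\<^sub>C (A x + cadjoint A x))"

definition im_part :: "('a::chilbert_space \<Rightarrow> 'a) \<Rightarrow> 'a \<Rightarrow> 'a" where
  "im_part A = (\<lambda>x. (1 / (2 * \<i>)) *\<^sub>C (A x - cadjoint A x))"

text \<open>All values in the supremum are nonnegative. Inserting \<open>0\<close> only matters on the zero space,
  which has no unit vectors: there it gives numerical radius \<open>0\<close>, whereas the supremum of the
  empty set of reals is unspecified.\<close>

definition numerical_radius :: "('a::chilbert_space \<Rightarrow> 'a) \<Rightarrow> real" where
  "numerical_radius A = Sup (insert 0 {cmod (cinner (A x) x) | x. norm x = 1})"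

definition weighted_numerical_radius :: "real \<Rightarrow> ('a::chilbert_space \<Rightarrow> 'a) \<Rightarrow> real" where
  "weighted_numerical_radius t A =
     numerical_radius (\<lambda>x. complex_of_real (1 - 2 * t) *\<^sub>C cadjoint A x + A x)"

end

theory Submission
  imports Defs
begin

text \<open>With \<open>X = \<Re>A\<close> and \<open>Y = \<Im>A\<close> one has \<open>\<omega>\<^sub>t(A)/2 = N(1 - t, t)\<close> for
  \<open>N(p, q) = \<omega>(p X + \<i> q Y)\<close>, a seminorm on the plane. Since \<open>N(p, q) \<le> \<bar>p\<bar> \<parallel>X\<parallel> + \<bar>q\<bar> \<parallel>Y\<parallel>\<close>, the
  function \<open>D(p, q) = p \<parallel>X\<parallel> + q \<parallel>Y\<parallel> - N(p, q)\<close> is nonnegative, superadditive and homogeneous on the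
  quadrant, hence monotone there, so \<open>r D(1, 1) \<le> D(1 - t, t) \<le> R D(1, 1)\<close>. These are the first
  two claims; the last follows by integration, as \<open>r\<close> and \<open>R\<close> have integrals \<open>1/4\<close> and \<open>3/4\<close>.\<close>

section \<open>Complex inner product spaces\<close>

lemma cinner_add_right: "cinner (x::'a::complex_inner) (y + z) = cinner x y + cinner x z"
  by (metis cinner_commute cinner_add_left complex_cnj_add)

lemma cinner_scaleC_right: "cinner (x::'a::complex_inner) (c *\<^sub>C y) = cnj c * cinner x y"
  by (metis cinner_commute cinner_scaleC_left complex_cnj_mult)

lemma cinner_scaleR_left: "cinner (r *\<^sub>R x) (y::'a::complex_inner) = of_real r * cinner x y"
  by (simp add: scaleR_scaleC cinner_scaleC_left)

lemma cinner_scaleR_right: "cinner (x::'a::complex_inner) (r *\<^sub>R y) = of_real r * cinner x y"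
  by (simp add: scaleR_scaleC cinner_scaleC_right)

lemma cinner_minus_right: "cinner (x::'a::complex_inner) (- y) = - cinner x y"
  using cinner_scaleR_right[of x "-1" y] by simp

lemma cinner_diff_right: "cinner (x::'a::complex_inner) (y - z) = cinner x y - cinner x z"
  using cinner_add_right[of x y "- z"] by (simp add: cinner_minus_right)

lemma Re_cinner_commute: "Re (cinner x (y::'a::complex_inner)) = Re (cinner y x)"
  by (metis cinner_commute complex_cnj_cnj cnj.simps(1))

lemma power2_norm_eq_cinner: "(norm (x::'a::complex_inner))\<^sup>2 = Re (cinner x x)"
  by (simp add: norm_eq_sqrt_cinner cinner_ge_zero)

text \<open>One expansion serves three purposes: the real Cauchy-Schwarz inequality (s = 1), the
  parallelogram law (s = 1 and s = -1) and the variation of an energy functional along a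
  line.\<close>

lemma power2_norm_add_scaleR:
  "(norm (x + s *\<^sub>R y))\<^sup>2 = (norm x)\<^sup>2 + 2 * s * Re (cinner x y) + s\<^sup>2 * (norm (y::'a::complex_inner))\<^sup>2"
  using Re_cinner_commute[of y x] unfolding power2_norm_eq_cinner power2_eq_square[of s]
  by (simp add: cinner_add_left cinner_add_right cinner_scaleR_left cinner_scaleR_right
      algebra_simps)

lemma norm_scaleC [simp]: "norm (c *\<^sub>C (x::'a::complex_inner)) = cmod c * norm x"
proof -
  have "(norm (c *\<^sub>C x))\<^sup>2 = Re ((c * cnj c) * cinner x x)"
    by (simp add: power2_norm_eq_cinner cinner_scaleC_left cinner_scaleC_right mult.assoc
        mult.left_commute)
  also have "\<dots> = (cmod c * norm x)\<^sup>2"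
    by (simp add: complex_norm_square[symmetric] power2_norm_eq_cinner power_mult_distrib)
  finally show ?thesis
    by simp
qed

text \<open>The triangle inequality for the norm is part of the class, so squaring it and cancelling
  the square terms leaves the real Cauchy-Schwarz inequality.\<close>

lemma Re_cinner_le_norm: "Re (cinner x y) \<le> norm x * norm (y::'a::complex_inner)"
proof -
  have "(norm (x + y))\<^sup>2 \<le> (norm x + norm y)\<^sup>2"
    by (intro power_mono norm_triangle_ineq) auto
  then show ?thesis
    using power2_norm_add_scaleR[of x 1 y] by (simp add: power2_sum)
qed

lemma cmod_cinner_le_norm: "cmod (cinner x y) \<le> norm x * norm (y::'a::complex_inner)"
proof (cases "cinner x y = 0")
  case False
  \<comment> \<open>A factor of modulus 1 that rotates \<open>cinner x y\<close> onto the positive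
    real axis, which reduces the claim to the bound for real parts.\<close>
  let ?c = "cnj (sgn (cinner x y))"
  have "?c * cinner x y = of_real (cmod (cinner x y))"
    using False complex_norm_square[of "cinner x y"]
    by (simp add: sgn_div_norm scaleR_conv_of_real field_simps power2_eq_square)
  then have "cmod (cinner x y) = Re (cinner (?c *\<^sub>C x) y)"
    by (simp add: cinner_scaleC_left)
  also have "\<dots> \<le> norm (?c *\<^sub>C x) * norm y"
    by (rule Re_cinner_le_norm)
  finally show ?thesis
    using False by (simp add: norm_sgn)
qed simp

lemma cinner_ext:
  assumes "\<And>x. cinner x y = cinner x (z::'a::complex_inner)"
  shows "y = z"
  using assms[of "y - z"] cinner_eq_zero_iff[of "y - z"] by (simp add: cinner_diff_right)

lemma bounded_linear_scaleC: "bounded_linear (\<lambda>x::'a::complex_inner. c *\<^sub>C x)"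
  by (rule bounded_linear_intro[where K = "cmod c"])
    (simp_all add: scaleC_add_right scaleR_scaleC scaleC_scaleC mult.commute)

section \<open>Adjoints\<close>

lemma Riesz_representation_real:
  fixes f :: "'a::chilbert_space \<Rightarrow> real"
  assumes "bounded_linear f"
  shows "\<exists>u. \<forall>x. f x = Re (cinner x u)"
proof -
  interpret f: bounded_linear f by fact
  text \<open>A minimiser of the energy functional \<open>J\<close> represents \<open>f\<close>; minimising sequences are Cauchy
    by the parallelogram law.\<close>
  define J where "J x = (norm x)\<^sup>2 - 2 * f x" for x
  \<comment> \<open>Completing the square: with K = \<open>onorm f\<close>, J x is at least (|x| -
    K)^2 - K^2.\<close>
  have "- (onorm f)\<^sup>2 \<le> J x" for x
  proof -
    have "f x \<le> onorm f * norm x"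
      using onorm[OF assms, of x] by simp
    moreover have "0 \<le> (norm x - onorm f)\<^sup>2"
      by simp
    ultimately show ?thesis
      by (simp add: J_def power2_diff algebra_simps)
  qed
  then have bdd: "bdd_below (range J)"
    by (auto intro: bdd_belowI[of _ "- (onorm f)\<^sup>2"])
  define m where "m = Inf (range J)"
  have m_le: "m \<le> J x" for x
    unfolding m_def using bdd by (intro cInf_lower) auto
  have "\<exists>x. J x < m + 1 / real (Suc n)" for n
    using cInf_lessD[of "range J" "m + 1 / real (Suc n)"] by (auto simp: m_def)
  then obtain X where X: "\<And>n. J (X n) < m + 1 / real (Suc n)"
    by metis
  \<comment> \<open>The linear parts of the three values of \<open>J\<close> cancel, so this is the
    parallelogram law for the norm alone.\<close>
  have parallelogram: "(norm (x - y))\<^sup>2 = 2 * J x + 2 * J y - 4 * J ((1/2) *\<^sub>R (x + y))" for x y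
  proof -
    have "4 * (norm ((1/2) *\<^sub>R (x + y)))\<^sup>2 = (norm (x + y))\<^sup>2"
      by (simp add: power_divide)
    moreover have "(norm (x - y))\<^sup>2 + (norm (x + y))\<^sup>2 = 2 * (norm x)\<^sup>2 + 2 * (norm y)\<^sup>2"
      using power2_norm_add_scaleR[of x "-1" y] power2_norm_add_scaleR[of x 1 y] by simp
    ultimately show ?thesis
      by (simp add: J_def f.add f.scaleR algebra_simps)
  qed
  \<comment> \<open>The midpoint has energy at least \<open>m\<close>, while both \<open>X i\<close>
    and \<open>X j\<close> exceed \<open>m\<close> by less than 1 / (n + 1).\<close>
  have near: "(norm (X i - X j))\<^sup>2 < 4 / real (Suc n)" if "n \<le> i" "n \<le> j" for n i j
  proof -
    have "1 / real (Suc i) \<le> 1 / real (Suc n)" "1 / real (Suc j) \<le> 1 / real (Suc n)"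
      using that by (simp_all add: field_simps)
    then show ?thesis
      using parallelogram[of "X i" "X j"] X[of i] X[of j] m_le[of "(1/2) *\<^sub>R (X i + X j)"]
      by linarith
  qed
  have "Cauchy X"
  proof (rule metric_CauchyI)
    fix e :: real assume "e > 0"
    then obtain n where n: "4 / e\<^sup>2 < real n"
      using reals_Archimedean2 by blast
    then have "4 / real (Suc n) < e\<^sup>2"
      using \<open>e > 0\<close> by (simp add: field_simps add_strict_increasing)
    then have "(norm (X i - X j))\<^sup>2 < e\<^sup>2" if "n \<le> i" "n \<le> j" for i j
      using near[OF that] by linarith
    then have "\<forall>i\<ge>n. \<forall>j\<ge>n. dist (X i) (X j) < e"
      using \<open>e > 0\<close> unfolding dist_norm by (meson less_imp_le power_less_imp_less_base)
    then show "\<exists>M. \<forall>i\<ge>M. \<forall>j\<ge>M. dist (X i) (X j) < e" ..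
  qed
  then obtain u where u: "X \<longlonglongrightarrow> u"
    using Cauchy_convergent convergent_def by blast
  have "(\<lambda>n. J (X n)) \<longlonglongrightarrow> J u"
    unfolding J_def by (intro tendsto_intros u f.tendsto)
  moreover have "(\<lambda>n. m + 1 / real (Suc n)) \<longlonglongrightarrow> m + 0"
    using LIMSEQ_inverse_real_of_nat by (intro tendsto_intros) (simp add: inverse_eq_divide)
  ultimately have "J u \<le> m + 0"
    using X by (intro LIMSEQ_le) (auto intro: less_imp_le)
  then have min: "J u \<le> J x" for x
    using m_le[of x] by linarith
  have "f x = Re (cinner x u)" for x
  proof -
    \<comment> \<open>\<open>2 * c\<close> is the derivative of \<open>J\<close> at \<open>u\<close>
      in direction \<open>x\<close>. The step \<open>s\<close> nearly minimises the quadratic 2 s c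
      + s^2 |x|^2; the added 1 keeps the denominator positive at x = 0. With this \<open>s\<close>
      the quadratic equals - s^2 (|x|^2 + 2), so minimality of \<open>u\<close> forces s = 0 and
      hence c = 0.\<close>
    define c where "c = Re (cinner u x) - f x"
    define s where "s = - c / ((norm x)\<^sup>2 + 1)"
    have pos: "(norm x)\<^sup>2 + 1 > 0"
      by (simp add: add_nonneg_pos)
    then have c: "c = - s * ((norm x)\<^sup>2 + 1)"
      by (simp add: s_def)
    have "J (u + s *\<^sub>R x) = J u + 2 * s * c + s\<^sup>2 * (norm x)\<^sup>2"
      by (simp add: J_def c_def power2_norm_add_scaleR f.add f.scaleR algebra_simps)
    then have "0 \<le> 2 * s * c + s\<^sup>2 * (norm x)\<^sup>2"
      using min[of "u + s *\<^sub>R x"] by linarith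
    then have "s\<^sup>2 * ((norm x)\<^sup>2 + 2) \<le> 0"
      by (simp add: c algebra_simps power2_eq_square)
    moreover have "(norm x)\<^sup>2 + 2 > 0"
      by (simp add: add_nonneg_pos)
    ultimately have "s = 0"
      by (simp add: mult_le_0_iff)
    then show ?thesis
      using c Re_cinner_commute[of u x] by (simp add: c_def)
  qed
  then show ?thesis
    by blast
qed

text \<open>This justifies the definite description in \<open>cadjoint\<close>. Existence comes from
  the real Riesz theorem applied to the real part of x |-> \<open>cinner (A x) y\<close>, uniqueness
  from \<open>cinner_ext\<close>.\<close>

lemma cinner_cadjoint:
  fixes A :: "'a::chilbert_space \<Rightarrow> 'a"
  assumes "bounded_clinear A"
  shows "cinner (A x) y = cinner x (cadjoint A y)"
proof -
  interpret A: bounded_linear A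
    using assms by (simp add: bounded_clinear_def)
  have A_scaleC: "A (c *\<^sub>C x) = c *\<^sub>C A x" for c x
    using assms by (simp add: bounded_clinear_def)
  have "\<exists>u. \<forall>x. cinner (A x) y = cinner x u" for y
  proof -
    have "bounded_linear (\<lambda>x. Re (cinner (A x) y))"
    proof (rule bounded_linear_intro[where K = "onorm A * norm y"])
      fix x
      have "\<bar>Re (cinner (A x) y)\<bar> \<le> norm (A x) * norm y"
        using abs_Re_le_cmod cmod_cinner_le_norm order_trans by blast
      also have "\<dots> \<le> onorm A * norm x * norm y"
        by (intro mult_right_mono onorm A.bounded_linear_axioms) simp
      finally show "norm (Re (cinner (A x) y)) \<le> norm x * (onorm A * norm y)"
        by (simp add: mult_ac)
    qed (simp_all add: A.add A.scaleR cinner_add_left cinner_scaleR_left)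
    then obtain u where u: "\<And>x. Re (cinner (A x) y) = Re (cinner x u)"
      using Riesz_representation_real by blast
    \<comment> \<open>Since Re (i z) = - Im z, replacing x by i x in the identity of real parts
      gives that of imaginary parts.\<close>
    have "Im (cinner (A x) y) = Im (cinner x u)" for x
      using u[of "\<i> *\<^sub>C x"] by (simp add: A_scaleC cinner_scaleC_left)
    with u have "\<forall>x. cinner (A x) y = cinner x u"
      by (simp add: complex_eq_iff)
    then show ?thesis ..
  qed
  then obtain B where B: "\<forall>x y. cinner (A x) y = cinner x (B y)"
    by metis
  have "cadjoint A = B"
    unfolding cadjoint_def
  proof (rule the_equality)
    show "\<forall>x y. cinner (A x) y = cinner x (B y)"
      by (rule B)
    fix C assume C: "\<forall>x y. cinner (A x) y = cinner x (C y)"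
    show "C = B"
      by (rule ext, rule cinner_ext) (metis B C)
  qed
  with B show ?thesis
    by simp
qed

text \<open>Linearity is read off from the defining relation by pairing with arbitrary vectors. For
  the bound, |A* x|^2 = Re <A (A* x), x>, which Cauchy-Schwarz estimates by |A| |A* x| |x|; then one
  factor |A* x| is divided out.\<close>

lemma bounded_linear_cadjoint:
  fixes A :: "'a::chilbert_space \<Rightarrow> 'a"
  assumes "bounded_clinear A"
  shows "bounded_linear (cadjoint A)"
proof (rule bounded_linear_intro[where K = "onorm A"])
  note adj = cinner_cadjoint[OF assms, symmetric]
  have A: "bounded_linear A"
    using assms by (simp add: bounded_clinear_def)
  show "cadjoint A (x + y) = cadjoint A x + cadjoint A y" for x y
    by (rule cinner_ext) (simp add: adj cinner_add_right)
  show "cadjoint A (r *\<^sub>R x) = r *\<^sub>R cadjoint A x" for r x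
    by (rule cinner_ext) (simp add: adj cinner_scaleR_right)
  show "norm (cadjoint A x) \<le> norm x * onorm A" for x
  proof (cases "cadjoint A x = 0")
    case True
    then show ?thesis
      using onorm_pos_le[OF A] by simp
  next
    case False
    let ?b = "cadjoint A x"
    have "(norm ?b)\<^sup>2 = Re (cinner (A ?b) x)"
      by (simp add: power2_norm_eq_cinner adj)
    also have "\<dots> \<le> norm (A ?b) * norm x"
      by (rule Re_cinner_le_norm)
    also have "\<dots> \<le> onorm A * norm ?b * norm x"
      by (intro mult_right_mono onorm A) simp
    finally show ?thesis
      using False by (simp add: power2_eq_square mult_ac)
  qed
qed

lemma bounded_linear_re_part: "bounded_clinear A \<Longrightarrow> bounded_linear (re_part A)"
  unfolding re_part_def
  by (intro bounded_linear_compose[OF bounded_linear_scaleC] bounded_linear_add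
      bounded_linear_cadjoint) (simp_all add: bounded_clinear_def)

lemma bounded_linear_im_part: "bounded_clinear A \<Longrightarrow> bounded_linear (im_part A)"
  unfolding im_part_def
  by (intro bounded_linear_compose[OF bounded_linear_scaleC] bounded_linear_sub
      bounded_linear_cadjoint) (simp_all add: bounded_clinear_def)

section \<open>The numerical radius\<close>

lemma bdd_above_numerical_range:
  fixes T :: "'a::chilbert_space \<Rightarrow> 'a"
  assumes "bounded_linear T"
  shows "bdd_above (insert 0 {cmod (cinner (T x) x) |x. norm x = 1})"
proof -
  have "cmod (cinner (T x) x) \<le> onorm T" if "norm x = 1" for x
    using cmod_cinner_le_norm[of "T x" x] onorm[OF assms, of x] that by simp
  then show ?thesis
    using onorm_pos_le[OF assms] by (auto intro!: bdd_aboveI[of _ "onorm T"])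
qed

lemma cmod_cinner_le_numerical_radius:
  fixes T :: "'a::chilbert_space \<Rightarrow> 'a"
  assumes "bounded_linear T" "norm x = 1"
  shows "cmod (cinner (T x) x) \<le> numerical_radius T"
  unfolding numerical_radius_def
  using assms by (intro cSup_upper bdd_above_numerical_range) auto

text \<open>The hypothesis \<open>0 \<le> c\<close> accounts for the element 0 inserted into the
  supremum.\<close>

lemma numerical_radius_le:
  fixes T :: "'a::chilbert_space \<Rightarrow> 'a"
  assumes "0 \<le> c" "\<And>x. norm x = 1 \<Longrightarrow> cmod (cinner (T x) x) \<le> c"
  shows "numerical_radius T \<le> c"
  unfolding numerical_radius_def using assms by (intro cSup_least) auto

lemma numerical_radius_nonneg:
  fixes T :: "'a::chilbert_space \<Rightarrow> 'a"
  assumes "bounded_linear T"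
  shows "0 \<le> numerical_radius T"
  unfolding numerical_radius_def
  using assms by (intro cSup_upper bdd_above_numerical_range) auto

lemma numerical_radius_le_onorm:
  fixes T :: "'a::chilbert_space \<Rightarrow> 'a"
  assumes "bounded_linear T"
  shows "numerical_radius T \<le> onorm T"
proof (rule numerical_radius_le)
  show "cmod (cinner (T x) x) \<le> onorm T" if "norm x = 1" for x
    using cmod_cinner_le_norm[of "T x" x] onorm[OF assms(1), of x] that by simp
qed (rule onorm_pos_le[OF assms])

lemma numerical_radius_add_le:
  fixes S T :: "'a::chilbert_space \<Rightarrow> 'a"
  assumes "bounded_linear S" "bounded_linear T"
  shows "numerical_radius (\<lambda>x. S x + T x) \<le> numerical_radius S + numerical_radius T"
proof (rule numerical_radius_le)
  fix x :: 'a assume "norm x = 1"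
  then show "cmod (cinner (S x + T x) x) \<le> numerical_radius S + numerical_radius T"
    using norm_triangle_ineq[of "cinner (S x) x" "cinner (T x) x"]
      cmod_cinner_le_numerical_radius[OF assms(1)] cmod_cinner_le_numerical_radius[OF assms(2)]
    by (fastforce simp: cinner_add_left)
qed (intro add_nonneg_nonneg numerical_radius_nonneg assms)

lemma numerical_radius_scaleC_le:
  fixes T :: "'a::chilbert_space \<Rightarrow> 'a"
  assumes "bounded_linear T"
  shows "numerical_radius (\<lambda>x. c *\<^sub>C T x) \<le> cmod c * numerical_radius T"
proof (rule numerical_radius_le)
  fix x :: 'a assume "norm x = 1"
  then show "cmod (cinner (c *\<^sub>C T x) x) \<le> cmod c * numerical_radius T"
    using cmod_cinner_le_numerical_radius[OF assms]
    by (simp add: cinner_scaleC_left norm_mult mult_left_mono)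
qed (intro mult_nonneg_nonneg norm_ge_zero numerical_radius_nonneg assms)

text \<open>The reverse inequality is the direct one for the factor \<open>inverse c\<close> and the
  operator \<open>c *\<^sub>C T x\<close>.\<close>

lemma numerical_radius_scaleC:
  fixes T :: "'a::chilbert_space \<Rightarrow> 'a"
  assumes "bounded_linear T"
  shows "numerical_radius (\<lambda>x. c *\<^sub>C T x) = cmod c * numerical_radius T"
proof (rule antisym)
  show "cmod c * numerical_radius T \<le> numerical_radius (\<lambda>x. c *\<^sub>C T x)"
  proof (cases "c = 0")
    case True
    then show ?thesis
      using numerical_radius_nonneg[OF bounded_linear_compose[OF bounded_linear_scaleC assms]]
      by simp
  next
    case False
    then have "numerical_radius T = numerical_radius (\<lambda>x. inverse c *\<^sub>C c *\<^sub>C T x)"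
      by (simp add: scaleC_scaleC scaleC_one)
    also have "\<dots> \<le> cmod (inverse c) * numerical_radius (\<lambda>x. c *\<^sub>C T x)"
      by (rule numerical_radius_scaleC_le[OF bounded_linear_compose[OF bounded_linear_scaleC assms]])
    finally show ?thesis
      using False by (simp add: norm_inverse norm_divide field_simps)
  qed
qed (rule numerical_radius_scaleC_le[OF assms])

section \<open>Planar seminorms\<close>

locale planar_seminorm =
  fixes N :: "real \<Rightarrow> real \<Rightarrow> real" and a b :: real
  assumes subadditive: "N (p + p') (q + q') \<le> N p q + N p' q'"
    and homogeneous: "0 \<le> c \<Longrightarrow> N (c * p) (c * q) = c * N p q"
    and bounded: "N p q \<le> \<bar>p\<bar> * a + \<bar>q\<bar> * b"
begin

definition defect :: "real \<Rightarrow> real \<Rightarrow> real"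
  where "defect p q = p * a + q * b - N p q"

text \<open>Subadditivity of \<open>N\<close> makes \<open>defect\<close> superadditive, and the
  increment (p' - p, q' - q) lies in the closed first quadrant, where \<open>bounded\<close> makes
  \<open>defect\<close> nonnegative.\<close>

lemma defect_mono:
  assumes "p \<le> p'" "q \<le> q'"
  shows "defect p q \<le> defect p' q'"
  using subadditive[of p "p' - p" q "q' - q"] bounded[of "p' - p" "q' - q"] assms
  by (simp add: defect_def algebra_simps)

lemma defect_diagonal: "0 \<le> c \<Longrightarrow> defect c c = c * defect 1 1"
  using homogeneous[of c 1 1] by (simp add: defect_def algebra_simps)

text \<open>The point (1 - t, t) lies componentwise below (R, R) with R the maximum, and on the
  diagonal \<open>defect\<close> is linear. The lower bound compares with the minimum in the same
  way.\<close>

lemma defect_le_max: "0 \<le> t \<Longrightarrow> defect (1 - t) t \<le> max t (1 - t) * defect 1 1"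
  using defect_mono[of "1 - t" "max t (1 - t)" t "max t (1 - t)"]
    defect_diagonal[of "max t (1 - t)"]
  by simp

lemma min_le_defect: "0 \<le> t \<Longrightarrow> t \<le> 1 \<Longrightarrow> min t (1 - t) * defect 1 1 \<le> defect (1 - t) t"
  using defect_mono[of "min t (1 - t)" "1 - t" "min t (1 - t)" t]
    defect_diagonal[of "min t (1 - t)"]
  by simp

text \<open>The reverse triangle inequality; it makes \<open>N\<close> Lipschitz along the segment,
  with constant \<open>a + b\<close>.\<close>

lemma N_diff_le: "N p q - N p' q' \<le> \<bar>p - p'\<bar> * a + \<bar>q - q'\<bar> * b"
  using subadditive[of p' "p - p'" q' "q - q'"] bounded[of "p - p'" "q - q'"] by simp

lemma continuous_segment: "continuous_on S (\<lambda>t. N (1 - t) t)"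
proof (rule continuous_onI)
  fix s e :: real
  assume "e > 0"
  \<comment> \<open>The denominator is a positive upper bound for the Lipschitz constant
    \<open>a + b\<close>.\<close>
  let ?d = "e / (\<bar>a + b\<bar> + 1)"
  have "dist (N (1 - t) t) (N (1 - s) s) < e" if "dist t s < ?d" for t
  proof -
    have "\<bar>N (1 - t) t - N (1 - s) s\<bar> \<le> \<bar>t - s\<bar> * (a + b)"
      using N_diff_le[of "1 - t" t "1 - s" s] N_diff_le[of "1 - s" s "1 - t" t]
      by (simp add: abs_minus_commute algebra_simps)
    also have "\<dots> \<le> \<bar>t - s\<bar> * (\<bar>a + b\<bar> + 1)"
      by (intro mult_left_mono) auto
    also have "\<dots> < e"
      using that \<open>e > 0\<close> by (simp add: dist_real_def pos_less_divide_eq)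
    finally show ?thesis
      by (simp add: dist_real_def)
  qed
  then show "\<exists>d>0. \<forall>t\<in>S. dist t s < d \<longrightarrow> dist (N (1 - t) t) (N (1 - s) s) \<le> e"
    using \<open>e > 0\<close> by (intro exI[of _ ?d]) (auto intro: less_imp_le)
qed

lemma integral_defect_bounds:
  "defect 1 1 / 4 \<le> integral {0..1} (\<lambda>t. defect (1 - t) t)"
  "integral {0..1} (\<lambda>t. defect (1 - t) t) \<le> 3 / 4 * defect 1 1"
proof -
  \<comment> \<open>The interval is split at 1/2, where the minimum changes from t to 1 - t; each
    half contributes 1/8.\<close>
  have min_int: "((\<lambda>t::real. min t (1 - t)) has_integral 1 / 4) {0..1}"
  proof -
    have "((\<lambda>t::real. t) has_integral (1/2)\<^sup>2 / 2 - 0\<^sup>2 / 2) {0..1/2}"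
      by (intro fundamental_theorem_of_calculus)
        (auto intro!: derivative_eq_intros simp: has_real_derivative_iff_has_vector_derivative[symmetric])
    then have 1: "((\<lambda>t::real. min t (1 - t)) has_integral (1/2)\<^sup>2 / 2 - 0\<^sup>2 / 2) {0..1/2}"
      by (rule has_integral_eq[rotated]) auto
    have "((\<lambda>t::real. 1 - t) has_integral (1 - 1\<^sup>2 / 2) - (1/2 - (1/2)\<^sup>2 / 2)) {1/2..1}"
      by (intro fundamental_theorem_of_calculus)
        (auto intro!: derivative_eq_intros simp: has_real_derivative_iff_has_vector_derivative[symmetric])
    then have 2: "((\<lambda>t::real. min t (1 - t)) has_integral (1 - 1\<^sup>2 / 2) - (1/2 - (1/2)\<^sup>2 / 2)) {1/2..1}"
      by (rule has_integral_eq[rotated]) auto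
    show ?thesis
      using has_integral_combine[OF _ _ 1 2] by (simp add: power2_eq_square)
  qed
  have "((\<lambda>t::real. 1 - min t (1 - t)) has_integral 1 - 1 / 4) {0..1}"
    using has_integral_diff[OF has_integral_const_real[of 1 0 1] min_int] by simp
  \<comment> \<open>The minimum and the maximum of t and 1 - t add up to 1.\<close>
  moreover have "(\<lambda>t::real. 1 - min t (1 - t)) = (\<lambda>t. max t (1 - t))"
    by (auto simp: min_def max_def)
  ultimately have max_int: "((\<lambda>t::real. max t (1 - t)) has_integral 3 / 4) {0..1}"
    by simp
  have "(\<lambda>t. defect (1 - t) t) integrable_on {0..1}"
    unfolding defect_def
    by (intro integrable_continuous_real continuous_intros continuous_segment)
  then have I: "((\<lambda>t. defect (1 - t) t) has_integral integral {0..1} (\<lambda>t. defect (1 - t) t)) {0..1}"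
    by (rule integrable_integral)
  show "defect 1 1 / 4 \<le> integral {0..1} (\<lambda>t. defect (1 - t) t)"
    using has_integral_le[OF has_integral_mult_left[OF min_int, of "defect 1 1"] I] min_le_defect
    by simp
  show "integral {0..1} (\<lambda>t. defect (1 - t) t) \<le> 3 / 4 * defect 1 1"
    using has_integral_le[OF I has_integral_mult_left[OF max_int, of "defect 1 1"]] defect_le_max
    by simp
qed

text \<open>Converts bounds on the integral of \<open>defect\<close> into bounds on that of
  \<open>N\<close>: the affine part (1 - t) a + t b has mean value (a + b) / 2.\<close>

lemma integral_segment:
  "integral {0..1} (\<lambda>t. N (1 - t) t) = (a + b) / 2 - integral {0..1} (\<lambda>t. defect (1 - t) t)"
proof -
  have "((\<lambda>t. (1 - t) * a + t * b) has_integral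
      ((1 - 1\<^sup>2 / 2) * a + 1\<^sup>2 / 2 * b) - ((0 - 0\<^sup>2 / 2) * a + 0\<^sup>2 / 2 * b)) {0..1}"
    by (intro fundamental_theorem_of_calculus)
      (auto intro!: derivative_eq_intros simp: has_real_derivative_iff_has_vector_derivative[symmetric])
  then have "integral {0..1} (\<lambda>t. (1 - t) * a + t * b) = (a + b) / 2"
    by (simp add: integral_unique field_simps)
  moreover have "integral {0..1} (\<lambda>t. defect (1 - t) t) =
      integral {0..1} (\<lambda>t. (1 - t) * a + t * b) - integral {0..1} (\<lambda>t. N (1 - t) t)"
    unfolding defect_def
    by (intro integral_diff integrable_continuous_real continuous_intros continuous_segment)
  ultimately show ?thesis
    by simp
qed

end

section \<open>The planar seminorm of an operator\<close>

lemma planar_seminorm_numerical_radius: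
  fixes X Y :: "'a::chilbert_space \<Rightarrow> 'a"
  assumes X: "bounded_linear X" and Y: "bounded_linear Y"
  shows "planar_seminorm
    (\<lambda>p q. numerical_radius (\<lambda>x. complex_of_real p *\<^sub>C X x + (\<i> * complex_of_real q) *\<^sub>C Y x))
    (onorm X) (onorm Y)"
proof
  have sX: "bounded_linear (\<lambda>x. c *\<^sub>C X x)" and sY: "bounded_linear (\<lambda>x. c *\<^sub>C Y x)" for c
    using X Y by (auto intro: bounded_linear_compose[OF bounded_linear_scaleC])
  note lin = bounded_linear_add[OF sX sY]
  let ?N = "\<lambda>p q. numerical_radius (\<lambda>x. complex_of_real p *\<^sub>C X x + (\<i> * complex_of_real q) *\<^sub>C Y x)"
  fix p q p' q' c :: real
  show "?N (p + p') (q + q') \<le> ?N p q + ?N p' q'"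
    using numerical_radius_add_le[OF lin lin, of "complex_of_real p" "\<i> * complex_of_real q"
        "complex_of_real p'" "\<i> * complex_of_real q'"]
    by (simp add: scaleC_add_left distrib_left add_ac)
  show "?N (c * p) (c * q) = c * ?N p q" if "0 \<le> c"
    using numerical_radius_scaleC[OF lin, of "complex_of_real c" "complex_of_real p" "\<i> * complex_of_real q"] that
    by (simp add: scaleC_add_right scaleC_scaleC mult_ac)
  have "?N p q \<le> numerical_radius (\<lambda>x. complex_of_real p *\<^sub>C X x)
      + numerical_radius (\<lambda>x. (\<i> * complex_of_real q) *\<^sub>C Y x)"
    by (rule numerical_radius_add_le[OF sX sY])
  also have "\<dots> \<le> \<bar>p\<bar> * onorm X + \<bar>q\<bar> * onorm Y"
    using numerical_radius_le_onorm[OF X] numerical_radius_le_onorm[OF Y]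
    by (simp add: numerical_radius_scaleC X Y norm_mult add_mono mult_left_mono)
  finally show "?N p q \<le> \<bar>p\<bar> * onorm X + \<bar>q\<bar> * onorm Y" .
qed

text \<open>The Cartesian decomposition A = Re A + i Im A. The factors
  \<open>complex_of_real 1\<close> are kept so that the right-hand side is literally the planar
  seminorm at (1, 1).\<close>

lemma numerical_radius_re_im:
  fixes A :: "'a::chilbert_space \<Rightarrow> 'a"
  shows "numerical_radius A =
    numerical_radius (\<lambda>x. complex_of_real 1 *\<^sub>C re_part A x + (\<i> * complex_of_real 1) *\<^sub>C im_part A x)"
proof -
  have "A x = complex_of_real 1 *\<^sub>C re_part A x + (\<i> * complex_of_real 1) *\<^sub>C im_part A x" for x
  proof -
    have "A x = (1/2) *\<^sub>R ((A x + cadjoint A x) + (A x - cadjoint A x))"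
      by (simp add: scaleR_half_double)
    also have "\<dots> = (1/2) *\<^sub>R (A x + cadjoint A x) + (1/2) *\<^sub>R (A x - cadjoint A x)"
      by (rule scaleR_add_right)
    finally show ?thesis
      by (simp add: re_part_def im_part_def scaleC_scaleC scaleC_one scaleR_scaleC)
  qed
  then show ?thesis
    by (intro arg_cong[where f = numerical_radius] ext)
qed

lemma weighted_numerical_radius_re_im:
  fixes A :: "'a::chilbert_space \<Rightarrow> 'a"
  assumes "bounded_clinear A"
  shows "weighted_numerical_radius t A = 2 *
    numerical_radius (\<lambda>x. complex_of_real (1 - t) *\<^sub>C re_part A x + (\<i> * complex_of_real t) *\<^sub>C im_part A x)"
proof -
  interpret planar_seminorm
    "\<lambda>p q. numerical_radius (\<lambda>x. complex_of_real p *\<^sub>C re_part A x + (\<i> * complex_of_real q) *\<^sub>C im_part A x)"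
    "onorm (re_part A)" "onorm (im_part A)"
    by (intro planar_seminorm_numerical_radius bounded_linear_re_part bounded_linear_im_part assms)
  have "complex_of_real (1 - 2 * t) *\<^sub>C cadjoint A x + A x =
    complex_of_real (2 * (1 - t)) *\<^sub>C re_part A x + (\<i> * complex_of_real (2 * t)) *\<^sub>C im_part A x" for x
  proof -
    have re: "complex_of_real (2 * (1 - t)) *\<^sub>C re_part A x = (1 - t) *\<^sub>R (A x + cadjoint A x)"
      by (simp add: re_part_def scaleC_scaleC scaleR_scaleC diff_divide_distrib)
    have im: "(\<i> * complex_of_real (2 * t)) *\<^sub>C im_part A x = t *\<^sub>R (A x - cadjoint A x)"
      by (simp add: im_part_def scaleC_scaleC scaleR_scaleC mult_ac)
    have "complex_of_real (1 - 2 * t) *\<^sub>C cadjoint A x = ((1 - t) - t) *\<^sub>R cadjoint A x"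
      by (simp add: scaleR_scaleC)
    also have "\<dots> = (1 - t) *\<^sub>R cadjoint A x - t *\<^sub>R cadjoint A x"
      by (rule scaleR_diff_left)
    finally show ?thesis
      unfolding re im by (simp add: algebra_simps)
  qed
  then have "weighted_numerical_radius t A = numerical_radius
      (\<lambda>x. complex_of_real (2 * (1 - t)) *\<^sub>C re_part A x + (\<i> * complex_of_real (2 * t)) *\<^sub>C im_part A x)"
    unfolding weighted_numerical_radius_def by (intro arg_cong[where f = numerical_radius] ext)
  then show ?thesis
    using homogeneous[of 2 "1 - t" t] by simp
qed

theorem corollary2p4:
  fixes A :: "'a::chilbert_space \<Rightarrow> 'a"
  assumes "bounded_clinear A"
  shows "(\<forall>t::real. 0 \<le> t \<and> t \<le> 1 \<longrightarrow>
            (1 / max t (1 - t)) *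
              ((1 - t) * onorm (re_part A) + t * onorm (im_part A)
                - (1 / 2) * weighted_numerical_radius t A)
            \<le> onorm (re_part A) + onorm (im_part A) - numerical_radius A)
       \<and> (\<forall>t::real. 0 < t \<and> t < 1 \<longrightarrow>
            onorm (re_part A) + onorm (im_part A) - numerical_radius A
            \<le> (1 / min t (1 - t)) *
              ((1 - t) * onorm (re_part A) + t * onorm (im_part A)
                - (1 / 2) * weighted_numerical_radius t A))
       \<and> 2 * integral {0..1} (\<lambda>t. weighted_numerical_radius t A)
              - (onorm (re_part A) + onorm (im_part A))
            \<le> numerical_radius A
       \<and> numerical_radius A
            \<le> (2 / 3) * integral {0..1} (\<lambda>t. weighted_numerical_radius t A)
              + (1 / 3) * (onorm (re_part A) + onorm (im_part A))"
proof -
  let ?N = "\<lambda>p q. numerical_radius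
    (\<lambda>x. complex_of_real p *\<^sub>C re_part A x + (\<i> * complex_of_real q) *\<^sub>C im_part A x)"
  interpret planar_seminorm ?N "onorm (re_part A)" "onorm (im_part A)"
    by (intro planar_seminorm_numerical_radius bounded_linear_re_part bounded_linear_im_part assms)
  \<comment> \<open>The unweighted difference is the defect at (1, 1), the weighted one the defect
    at (1 - t, t).\<close>
  have whole: "onorm (re_part A) + onorm (im_part A) - numerical_radius A = defect 1 1"
    by (simp only: defect_def numerical_radius_re_im[of A])
  have part: "(1 - t) * onorm (re_part A) + t * onorm (im_part A)
      - 1 / 2 * weighted_numerical_radius t A = defect (1 - t) t" for t
    by (simp add: defect_def weighted_numerical_radius_re_im[OF assms])
  have int: "integral {0..1} (\<lambda>t. weighted_numerical_radius t A)
      = onorm (re_part A) + onorm (im_part A) - 2 * integral {0..1} (\<lambda>t. defect (1 - t) t)"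
    using integral_segment by (simp add: weighted_numerical_radius_re_im[OF assms])
  have "1 / max t (1 - t) * defect (1 - t) t \<le> defect 1 1" if "0 \<le> t" "t \<le> 1" for t
  proof -
    have "max t (1 - t) > 0"
      using that by (auto simp: max_def)
    then show ?thesis
      using defect_le_max[OF that(1)] by (simp add: pos_divide_le_eq mult.commute)
  qed
  moreover have "defect 1 1 \<le> 1 / min t (1 - t) * defect (1 - t) t" if "0 < t" "t < 1" for t
    using min_le_defect[of t] that by (simp add: pos_le_divide_eq mult.commute)
  \<comment> \<open>Let s be the sum of the two norms, I the integral of the defect along the
    segment and D its value at (1, 1). As the numerical radius is s - D and the weighted one has
    integral s - 2 I, the last two claims amount to D \<le> 4 I and I \<le> 3/4 D.\<close>
  ultimately show ?thesis
    unfolding whole part int using integral_defect_bounds whole by (auto simp: field_simps)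
qed

end
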